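(* Let $F\in\{1_{4,1},F_9,F_{10},F_9^c,F_{10}^c\}$ and $G\in\{F_{11},F_{13}\}$. Then, as $m\to\infty$, $$\mathrm{forb}(m,\{F,G\})=O(m^2).$$
   Context: A matrix is simple if it is a $(0,1)$-matrix with no repeated columns. $F\prec A$ means that some submatrix of $A$ is a row and column permutation of $F$. For a family $\mathcal F$ of $(0,1)$-matrices, $\mathrm{forb}(m,\mathcal F)$ is the maximum number of columns of an $m$-rowed simple matrix $A$ with $F\nprec A$ for all $F\in\mathcal F$. $A^c$ denotes the $(0,1)$-complement of $A$. $1_{4,1}$ is the $4\times 1$ column of $1$'s, and $$F_9=\begin{bmatrix}1&0&0\\0&1&0\\0&0&1\\0&0&1\end{bmatrix},\quad F_{10}=\begin{bmatrix}1&0&0\\0&1&0\\0&0&1\\0&0&0\end{bmatrix},\quad F_{11}=\begin{bmatrix}1&0&1&0\\1&0&0&1\\0&1&1&0\\0&1&0&1\end{bmatrix},\quad F_{13}=\begin{bmatrix}1&1&0&0\\0&1&1&0\\0&1&0&1\\0&0&1&1\end{bmatrix}.$$ *)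

theory Defs
  imports
    "Jordan_Normal_Form.DL_Submatrix"
    "HOL-Combinatorics.Permutations"
    "HOL-Library.Landau_Symbols"
begin

definition is_01_mat :: "int mat \<Rightarrow> bool" where
  "is_01_mat A \<longleftrightarrow> elements_mat A \<subseteq> {0, 1}"

definition simple_mat :: "int mat \<Rightarrow> bool" where
  "simple_mat A \<longleftrightarrow> is_01_mat A \<and> distinct (cols A)"

definition row_col_perm :: "'a mat \<Rightarrow> 'a mat \<Rightarrow> bool" where
  "row_col_perm F B \<longleftrightarrow>
     (\<exists>p q. p permutes {..<dim_row F} \<and> q permutes {..<dim_col F} \<and>
        B = mat (dim_row F) (dim_col F) (\<lambda>(i, j). F $$ (p i, q j)))"

definition configuration :: "'a mat \<Rightarrow> 'a mat \<Rightarrow> bool" (infix \<open>\<prec>\<close> 50) where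
  "F \<prec> A \<longleftrightarrow> (\<exists>I J. row_col_perm F (submatrix A I J))"

definition avoiding :: "nat \<Rightarrow> int mat set \<Rightarrow> int mat set" where
  "avoiding m \<F> = {A. simple_mat A \<and> dim_row A = m \<and> (\<forall>F\<in>\<F>. \<not> F \<prec> A)}"

text \<open>The maximum is over a finite set, and over a nonempty one as soon as every
  member of the family has a column; see \<open>finite_avoiding_dims\<close> and
  \<open>avoiding_dims_nonempty\<close> below.\<close>

definition forb :: "nat \<Rightarrow> int mat set \<Rightarrow> nat" where
  "forb m \<F> = Max (dim_col ` avoiding m \<F>)"

definition complement_mat :: "int mat \<Rightarrow> int mat" where
  "complement_mat A = map_mat (\<lambda>x. 1 - x) A"

definition ones_mat :: "nat \<Rightarrow> nat \<Rightarrow> int mat" where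
  "ones_mat k l = mat k l (\<lambda>_. 1)"

definition F9 :: "int mat" where
  "F9 = mat_of_rows_list 3
    [[1, 0, 0],
     [0, 1, 0],
     [0, 0, 1],
     [0, 0, 1]]"

definition F10 :: "int mat" where
  "F10 = mat_of_rows_list 3
    [[1, 0, 0],
     [0, 1, 0],
     [0, 0, 1],
     [0, 0, 0]]"

definition F11 :: "int mat" where
  "F11 = mat_of_rows_list 4
    [[1, 0, 1, 0],
     [1, 0, 0, 1],
     [0, 1, 1, 0],
     [0, 1, 0, 1]]"

definition F13 :: "int mat" where
  "F13 = mat_of_rows_list 4
    [[1, 1, 0, 0],
     [0, 1, 1, 0],
     [0, 1, 0, 1],
     [0, 0, 1, 1]]"

lemma finite_avoiding_dims: "finite (dim_col ` avoiding m \<F>)"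
proof -
  define S where "S = vec m ` (PiE {..<m} (\<lambda>_. {0, 1 :: int}))"
  have "finite S"
    unfolding S_def by (intro finite_imageI finite_PiE) auto
  have "dim_col A \<le> card S" if "A \<in> avoiding m \<F>" for A
  proof -
    from that have A: "elements_mat A \<subseteq> {0, 1}" "distinct (cols A)" "dim_row A = m"
      by (auto simp: avoiding_def simple_mat_def is_01_mat_def)
    have "set (cols A) \<subseteq> S"
    proof
      fix v assume "v \<in> set (cols A)"
      then obtain j where j: "j < dim_col A" "v = col A j"
        by (auto simp: cols_def)
      have "A $$ (i, j) \<in> {0, 1}" if "i < m" for i
      proof -
        have "A $$ (i, j) \<in> elements_mat A"
          by (rule elements_matI[of A m "dim_col A" i j]) (use A(3) j(1) that in auto)
        with A(1) show ?thesis
          by blast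
      qed
      then have "(\<lambda>i\<in>{..<m}. A $$ (i, j)) \<in> PiE {..<m} (\<lambda>_. {0, 1})"
        by (simp add: PiE_iff)
      moreover have "v = vec m (\<lambda>i\<in>{..<m}. A $$ (i, j))"
        using j A(3) by (intro eq_vecI) auto
      ultimately show "v \<in> S"
        unfolding S_def by blast
    qed
    then have "card (set (cols A)) \<le> card S"
      using \<open>finite S\<close> by (rule card_mono[rotated])
    then show ?thesis
      using A(2) by (simp add: distinct_card)
  qed
  then have "dim_col ` avoiding m \<F> \<subseteq> {..card S}"
    by blast
  then show ?thesis
    by (rule finite_subset) simp
qed

lemma avoiding_dims_nonempty:
  assumes "\<And>F. F \<in> \<F> \<Longrightarrow> dim_col F > 0"
  shows "dim_col ` avoiding m \<F> \<noteq> {}"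
proof -
  have "\<not> F \<prec> 0\<^sub>m m 0" if "F \<in> \<F>" for F
  proof
    assume "F \<prec> 0\<^sub>m m 0"
    then obtain I J where "row_col_perm F (submatrix (0\<^sub>m m 0) I J)"
      unfolding configuration_def by blast
    then have "dim_col (submatrix (0\<^sub>m m 0 :: int mat) I J) = dim_col F"
      unfolding row_col_perm_def by (elim exE conjE) (simp only: dim_col_mat)
    with assms[OF that] show False
      by (simp add: dim_submatrix)
  qed
  then have "0\<^sub>m m 0 \<in> avoiding m \<F>"
    by (auto simp: avoiding_def simple_mat_def is_01_mat_def elements_mat_def cols_def)
  then show ?thesis
    by blast
qed

end

theory Submission
  imports Defs
begin

text \<open>
  Columns are read as subsets of the row set. If a row \<open>r\<close> is deleted, the number of columns
  drops by the number of columns that occur both with \<open>0\<close> and with \<open>1\<close> in row \<open>r\<close>.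
  Iterating this twice, a simple matrix with more than \<open>m\<^sup>2 + 1\<close> columns has two rows
  \<open>r, s\<close> and three distinct columns on other rows, each of which occurs with all four values
  on \<open>r, s\<close>. Among three distinct sets either two are incomparable, or they form a chain. In the
  first case two further rows see \<open>{10, 01}\<close>, which together with the free rows \<open>r, s\<close> yields
  both \<open>F\<^sub>1\<^sub>1\<close> and \<open>F\<^sub>1\<^sub>3\<close>; in the second case they see \<open>{00, 10, 11}\<close>, which yields every
  admissible \<open>F\<close>.
\<close>

section \<open>Patterns on chosen rows, and deletion of a row\<close>

text \<open>The rows come as a list in arbitrary order, so row permutations need no separate
  treatment. Inclusion, not equality: other values may occur on \<open>xs\<close> as well.\<close>

definition has_pattern :: "bool list set \<Rightarrow> 'a set \<Rightarrow> 'a set set \<Rightarrow> bool" where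
  "has_pattern \<Phi> S \<A> \<longleftrightarrow>
     (\<exists>xs. distinct xs \<and> set xs \<subseteq> S \<and> \<Phi> \<subseteq> (\<lambda>A. map (\<lambda>x. x \<in> A) xs) ` \<A>)"

text \<open>This is the product of the one-rowed matrix [0 1] with the configuration that
  \<open>\<Phi>\<close> stands for.\<close>

definition free_row :: "bool list set \<Rightarrow> bool list set" where
  "free_row \<Phi> = {b # \<phi> | b \<phi>. \<phi> \<in> \<Phi>}"

lemma has_pattern_remove:
  assumes "has_pattern \<Phi> (S - {r}) ((\<lambda>A. A - {r}) ` \<A>)"
  shows "has_pattern \<Phi> S \<A>"
proof -
  from assms obtain xs where xs: "distinct xs" "set xs \<subseteq> S - {r}"
    "\<Phi> \<subseteq> (\<lambda>A. map (\<lambda>x. x \<in> A) xs) ` (\<lambda>A. A - {r}) ` \<A>"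
    unfolding has_pattern_def by auto
  have eq: "map (\<lambda>x. x \<in> A - {r}) xs = map (\<lambda>x. x \<in> A) xs" for A
    using xs(2) by auto
  then have "\<Phi> \<subseteq> (\<lambda>A. map (\<lambda>x. x \<in> A) xs) ` \<A>"
    using xs(3) by (simp only: image_image eq)
  with xs show ?thesis
    unfolding has_pattern_def by blast
qed

lemma has_pattern_free_row:
  assumes "has_pattern \<Phi> (S - {r}) {A. r \<notin> A \<and> A \<in> \<A> \<and> insert r A \<in> \<A>}" "r \<in> S"
  shows "has_pattern (free_row \<Phi>) S \<A>"
proof -
  from assms(1) obtain xs where xs: "distinct xs" "set xs \<subseteq> S - {r}"
    "\<Phi> \<subseteq> (\<lambda>A. map (\<lambda>x. x \<in> A) xs) ` {A. r \<notin> A \<and> A \<in> \<A> \<and> insert r A \<in> \<A>}"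
    unfolding has_pattern_def by auto
  have "b # \<phi> \<in> (\<lambda>A. map (\<lambda>x. x \<in> A) (r # xs)) ` \<A>" if \<phi>: "\<phi> \<in> \<Phi>" for b \<phi>
  proof -
    from \<phi> xs(3) obtain A where A: "r \<notin> A" "A \<in> \<A>" "insert r A \<in> \<A>"
      "\<phi> = map (\<lambda>x. x \<in> A) xs"
      by blast
    have "map (\<lambda>x. x \<in> insert r A) xs = \<phi>"
      using xs(2) A(4) by auto
    then show ?thesis
      using A by (cases b) (auto intro: image_eqI[of _ _ "insert r A"] image_eqI[of _ _ A])
  qed
  moreover have "distinct (r # xs)" "set (r # xs) \<subseteq> S"
    using xs assms(2) by auto
  ultimately show ?thesis
    unfolding has_pattern_def free_row_def by blast
qed

text \<open>Deleting \<open>r\<close> merges exactly the pairs \<open>A\<close>,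
  \<open>insert r A\<close> that both lie in the family. With \<open>\<A>0\<close> the members
  without \<open>r\<close> and \<open>\<B>\<close> the others after deletion, the union of the two
  is the deleted family and the intersection counts the merged pairs.\<close>

lemma card_delete_element:
  assumes "finite \<A>"
  shows "card \<A> = card ((\<lambda>A. A - {r}) ` \<A>) + card {A. r \<notin> A \<and> A \<in> \<A> \<and> insert r A \<in> \<A>}"
proof -
  define \<A>0 where "\<A>0 = {A \<in> \<A>. r \<notin> A}"
  define \<A>1 where "\<A>1 = {A \<in> \<A>. r \<in> A}"
  define \<B> where "\<B> = (\<lambda>A. A - {r}) ` \<A>1"
  have fin: "finite \<A>0" "finite \<A>1" "finite \<B>"
    using assms by (auto simp: \<A>0_def \<A>1_def \<B>_def)
  have "card \<B> = card \<A>1"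
    unfolding \<B>_def \<A>1_def by (intro card_image) (auto simp: inj_on_def)
  moreover have "\<A> = \<A>0 \<union> \<A>1" "\<A>0 \<inter> \<A>1 = {}"
    by (auto simp: \<A>0_def \<A>1_def)
  ultimately have "card \<A> = card \<A>0 + card \<B>"
    using fin by (simp add: card_Un_disjoint)
  moreover have "(\<lambda>A. A - {r}) ` \<A> = \<A>0 \<union> \<B>"
  proof -
    have "\<A>0 = (\<lambda>A. A - {r}) ` \<A>0"
      by (auto simp: \<A>0_def)
    then show ?thesis
      unfolding \<B>_def using \<open>\<A> = \<A>0 \<union> \<A>1\<close> by (metis image_Un)
  qed
  moreover have "{A. r \<notin> A \<and> A \<in> \<A> \<and> insert r A \<in> \<A>} = \<A>0 \<inter> \<B>"
  proof -
    have "A \<in> \<B> \<longleftrightarrow> insert r A \<in> \<A>" if "r \<notin> A" for A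
    proof
      assume "insert r A \<in> \<A>"
      then have "insert r A \<in> \<A>1" "A = insert r A - {r}"
        using that by (auto simp: \<A>1_def)
      then show "A \<in> \<B>"
        unfolding \<B>_def by (rule image_eqI[rotated])
    qed (auto simp: \<B>_def \<A>1_def insert_absorb)
    then show ?thesis
      by (auto simp: \<A>0_def)
  qed
  ultimately show ?thesis
    using card_Un_Int[OF fin(1,3)] by simp
qed

text \<open>Either the family with \<open>r\<close> deleted is still too large for the remaining
  rows, or more than \<open>f (card S)\<close> sets were merged; in the second case
  \<open>step\<close> finds a pattern in the merged sets, and \<open>r\<close> is a free row for it.
  The summand 1 covers the empty row set, which has a single subset.\<close>

lemma standard_induction:
  fixes S :: "'a set"
  assumes step: "\<And>T \<B>. finite T \<Longrightarrow> \<B> \<subseteq> Pow T \<Longrightarrow> card \<B> > f (card T) \<Longrightarrow>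
      \<exists>\<Phi>\<in>\<Psi>. has_pattern \<Phi> (T :: 'a set) \<B>"
    and "finite S" "\<A> \<subseteq> Pow S" "card \<A> > 1 + (\<Sum>i<card S. f i)"
  shows "\<exists>\<Phi>\<in>\<Psi>. has_pattern (free_row \<Phi>) S \<A>"
  using assms(2-)
proof (induction S arbitrary: \<A> rule: finite_induct)
  case empty
  then have "card \<A> \<le> card {{} :: 'a set}"
    by (intro card_mono) auto
  with empty show ?case
    by simp
next
  case (insert r S)
  define \<B> where "\<B> = (\<lambda>A. A - {r}) ` \<A>"
  define \<C> where "\<C> = {A. r \<notin> A \<and> A \<in> \<A> \<and> insert r A \<in> \<A>}"
  have sub: "\<B> \<subseteq> Pow S" "\<C> \<subseteq> Pow S"
    using insert.prems(1) by (auto simp: \<B>_def \<C>_def)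
  have S: "insert r S - {r} = S"
    using insert.hyps by auto
  have "finite \<A>"
    using insert by (meson finite_Pow_iff finite_insert finite_subset)
  then have "card \<A> = card \<B> + card \<C>"
    unfolding \<B>_def \<C>_def by (rule card_delete_element)
  then consider "card \<B> > 1 + (\<Sum>i<card S. f i)" | "card \<C> > f (card S)"
    using insert by fastforce
  then show ?case
  proof cases
    case 1
    obtain \<Phi> where "\<Phi> \<in> \<Psi>" "has_pattern (free_row \<Phi>) S \<B>"
      using insert.IH[OF sub(1) 1] by blast
    then have "has_pattern (free_row \<Phi>) (insert r S) \<A>"
      using has_pattern_remove[of _ "insert r S" r \<A>] unfolding S \<B>_def by blast
    with \<open>\<Phi> \<in> \<Psi>\<close> show ?thesis
      by blast
  next
    case 2
    obtain \<Phi> where "\<Phi> \<in> \<Psi>" "has_pattern \<Phi> S \<C>"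
      using step[OF insert.hyps(1) sub(2) 2] by blast
    then have "has_pattern (free_row \<Phi>) (insert r S) \<A>"
      using has_pattern_free_row[of _ "insert r S" r \<A>] unfolding S \<C>_def by blast
    with \<open>\<Phi> \<in> \<Psi>\<close> show ?thesis
      by blast
  qed
qed

section \<open>The quadratic bound for families of sets\<close>

definition I2 :: "bool list set" where
  "I2 = {[True, False], [False, True]}"

definition T2 :: "bool list set" where
  "T2 = {[False, False], [True, False], [True, True]}"

lemma has_pattern_I2_or_T2:
  assumes "\<A> \<subseteq> Pow S" "card \<A> > 2"
  shows "\<exists>\<Phi>\<in>{I2, T2}. has_pattern \<Phi> S \<A>"
proof (cases "\<exists>A\<in>\<A>. \<exists>B\<in>\<A>. \<not> A \<subseteq> B \<and> \<not> B \<subseteq> A")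
  case True
  then obtain A B p q where AB: "A \<in> \<A>" "B \<in> \<A>" "p \<in> A - B" "q \<in> B - A"
    by blast
  then have "I2 \<subseteq> (\<lambda>A. map (\<lambda>x. x \<in> A) [p, q]) ` \<A>"
    unfolding I2_def by (auto intro: image_eqI[of _ _ A] image_eqI[of _ _ B])
  moreover have "distinct [p, q]" "set [p, q] \<subseteq> S"
    using AB assms(1) by auto
  ultimately have "has_pattern I2 S \<A>"
    unfolding has_pattern_def by blast
  then show ?thesis
    by blast
next
  case False
  obtain \<B> where \<B>: "\<B> \<subseteq> \<A>" "card \<B> = 3"
    using assms(2) obtain_subset_with_card_n[of 3 \<A>] by auto
  then obtain A B C where "\<B> = {A, B, C}" "A \<noteq> B" "A \<noteq> C" "B \<noteq> C"
    by (auto simp: card_3_iff)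
  with \<B>(1) have ABC: "A \<in> \<A>" "B \<in> \<A>" "C \<in> \<A>" and ne: "A \<noteq> B" "A \<noteq> C" "B \<noteq> C"
    by simp_all
  \<comment> \<open>Three distinct, pairwise comparable sets form a chain in some order.\<close>
  have "A \<subset> B \<or> B \<subset> A" "A \<subset> C \<or> C \<subset> A" "B \<subset> C \<or> C \<subset> B"
    using False ABC ne by (simp_all only: psubset_eq) metis+
  then have "\<exists>A\<in>\<A>. \<exists>B\<in>\<A>. \<exists>C\<in>\<A>. A \<subset> B \<and> B \<subset> C"
    using ABC by (elim disjE) (meson | simp)+
  then obtain A B C p q where ABC: "A \<in> \<A>" "B \<in> \<A>" "C \<in> \<A>" "A \<subseteq> B" "B \<subseteq> C"
    "p \<in> B - A" "q \<in> C - B"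
    by blast
  \<comment> \<open>On \<open>[p, q]\<close> the chain \<open>A\<close>, \<open>B\<close>,
    \<open>C\<close> has the traces 00, 10, 11.\<close>
  then have "T2 \<subseteq> (\<lambda>A. map (\<lambda>x. x \<in> A) [p, q]) ` \<A>"
    unfolding T2_def
    by (auto intro: image_eqI[of _ _ A] image_eqI[of _ _ B] image_eqI[of _ _ C])
  moreover have "distinct [p, q]" "set [p, q] \<subseteq> S"
    using ABC assms(1) by auto
  ultimately have "has_pattern T2 S \<A>"
    unfolding has_pattern_def by blast
  then show ?thesis
    by blast
qed

text \<open>Two rounds of \<open>standard_induction\<close>: the constant threshold 2 sums to
  \<open>1 + 2 * n\<close>, and these odd numbers sum to n^2.\<close>

lemma has_pattern_quadratic:
  assumes "finite S" "\<A> \<subseteq> Pow S" "card \<A> > 1 + (card S)\<^sup>2"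
  shows "\<exists>\<Phi>\<in>{I2, T2}. has_pattern (free_row (free_row \<Phi>)) S \<A>"
proof -
  have linear: "\<exists>\<Phi>\<in>free_row ` {I2, T2}. has_pattern \<Phi> T \<B>"
    if T: "finite T" "\<B> \<subseteq> Pow T" "card \<B> > 1 + 2 * card T" for T :: "'a set" and \<B>
  proof -
    have "\<exists>\<Phi>\<in>{I2, T2}. has_pattern (free_row \<Phi>) T \<B>"
      by (rule standard_induction[OF has_pattern_I2_or_T2 T(1,2)]) (use T(3) in auto)
    then show ?thesis
      by simp
  qed
  have odd_sum: "(\<Sum>i<n. 1 + 2 * i) = n\<^sup>2" for n :: nat
    by (induction n) (auto simp: power2_eq_square)
  have "\<exists>\<Phi>\<in>free_row ` {I2, T2}. has_pattern (free_row \<Phi>) S \<A>"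
    by (rule standard_induction[OF linear assms(1,2)]) (use assms(3) odd_sum in auto)
  then show ?thesis
    by simp
qed

section \<open>From patterns back to configurations\<close>

text \<open>\<open>submatrix\<close> lists the chosen indices increasingly through
  \<open>pick\<close>, whereas \<open>\<rho>\<close> lists them in any order; \<open>p\<close>
  translates between the two. Outside \<open>{..<k}\<close> it is the identity, as
  \<open>permutes\<close> demands.\<close>

lemma permutes_of_inj:
  fixes \<rho> :: "nat \<Rightarrow> nat"
  assumes "inj_on \<rho> {..<k}" "\<rho> ` {..<k} = I"
  obtains p where "p permutes {..<k}" "\<And>i. i < k \<Longrightarrow> \<rho> (p i) = pick I i"
proof -
  have card: "card I = k"
    using assms card_image by fastforce
  define p where "p i = (if i < k then inv_into {..<k} \<rho> (pick I i) else i)" for i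
  have pick: "pick I i \<in> \<rho> ` {..<k}" if "i < k" for i
    using that card assms(2) pick_in_set_le by blast
  have \<rho>p: "\<rho> (p i) = pick I i" if "i < k" for i
    using pick[OF that] that by (simp add: p_def f_inv_into_f)
  have "inj_on p {..<k}"
  proof (rule inj_onI)
    fix i j assume ij: "i \<in> {..<k}" "j \<in> {..<k}" "p i = p j"
    then have "pick I i = pick I j"
      using \<rho>p by (metis lessThan_iff)
    \<comment> \<open>\<open>pick I\<close> is strictly increasing below \<open>card I\<close>,
      hence injective.\<close>
    then show "i = j"
      using ij card pick_mono_le[of _ I] by (metis lessThan_iff less_irrefl linorder_neqE_nat)
  qed
  moreover have "p ` {..<k} \<subseteq> {..<k}"
    using inv_into_into[OF pick] by (auto simp: p_def)
  ultimately have "bij_betw p {..<k} {..<k}"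
    by (simp add: bij_betw_def endo_inj_surj)
  then have "p permutes {..<k}"
    by (rule bij_imp_permutes) (simp add: p_def)
  with \<rho>p show thesis
    using that by blast
qed

lemma configurationI:
  assumes \<rho>: "inj_on \<rho> {..<dim_row F}" "\<rho> ` {..<dim_row F} \<subseteq> {..<dim_row A}"
    and \<kappa>: "inj_on \<kappa> {..<dim_col F}" "\<kappa> ` {..<dim_col F} \<subseteq> {..<dim_col A}"
    and eq: "\<And>i j. i < dim_row F \<Longrightarrow> j < dim_col F \<Longrightarrow> A $$ (\<rho> i, \<kappa> j) = F $$ (i, j)"
  shows "F \<prec> A"
proof -
  define I J where "I = \<rho> ` {..<dim_row F}" and "J = \<kappa> ` {..<dim_col F}"
  obtain p where p: "p permutes {..<dim_row F}" "\<And>i. i < dim_row F \<Longrightarrow> \<rho> (p i) = pick I i"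
    using permutes_of_inj[OF \<rho>(1)] I_def by metis
  obtain q where q: "q permutes {..<dim_col F}" "\<And>i. i < dim_col F \<Longrightarrow> \<kappa> (q i) = pick J i"
    using permutes_of_inj[OF \<kappa>(1)] J_def by metis
  have "{i. i < dim_row A \<and> i \<in> I} = I" "{j. j < dim_col A \<and> j \<in> J} = J"
    using \<rho>(2) \<kappa>(2) by (auto simp: I_def J_def)
  then have dims: "card {i. i < dim_row A \<and> i \<in> I} = dim_row F"
    "card {j. j < dim_col A \<and> j \<in> J} = dim_col F"
    using \<rho>(1) \<kappa>(1) by (simp_all add: I_def J_def card_image)
  have "submatrix A I J = mat (dim_row F) (dim_col F) (\<lambda>(i, j). F $$ (p i, q j))"
  proof (rule eq_matI)
    fix i j
    assume "i < dim_row (mat (dim_row F) (dim_col F) (\<lambda>(i, j). F $$ (p i, q j)))"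
      "j < dim_col (mat (dim_row F) (dim_col F) (\<lambda>(i, j). F $$ (p i, q j)))"
    then have ij: "i < dim_row F" "j < dim_col F"
      by auto
    then have "p i < dim_row F" "q j < dim_col F"
      using permutes_in_image[OF p(1)] permutes_in_image[OF q(1)] by auto
    then show "submatrix A I J $$ (i, j) =
        mat (dim_row F) (dim_col F) (\<lambda>(i, j). F $$ (p i, q j)) $$ (i, j)"
      using eq[of "p i" "q j"] p(2) q(2) ij dims by (simp add: submatrix_index)
  qed (simp_all add: dim_submatrix dims)
  with p(1) q(1) show ?thesis
    unfolding configuration_def row_col_perm_def by blast
qed

definition col_support :: "int mat \<Rightarrow> nat \<Rightarrow> nat set" where
  "col_support A j = {i. i < dim_row A \<and> A $$ (i, j) = 1}"

lemma is_01_mat_iff: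
  "is_01_mat A \<longleftrightarrow> (\<forall>i<dim_row A. \<forall>j<dim_col A. A $$ (i, j) = 0 \<or> A $$ (i, j) = 1)"
  unfolding is_01_mat_def elements_mat_def by fastforce

text \<open>A 0-1 column is determined by its ones, so counting columns of a simple matrix amounts
  to counting their supports.\<close>

lemma inj_on_col_support:
  assumes "simple_mat A"
  shows "inj_on (col_support A) {..<dim_col A}"
proof (rule inj_onI)
  fix j k assume jk: "j \<in> {..<dim_col A}" "k \<in> {..<dim_col A}" "col_support A j = col_support A k"
  have "A $$ (i, j) = A $$ (i, k)" if "i < dim_row A" for i
  proof -
    have "A $$ (i, j) = 1 \<longleftrightarrow> A $$ (i, k) = 1"
      using jk(3) that by (auto simp: col_support_def)
    moreover have "A $$ (i, j) \<in> {0, 1}" "A $$ (i, k) \<in> {0, 1}"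
      using assms jk that by (auto simp: simple_mat_def is_01_mat_iff)
    ultimately show ?thesis
      by auto
  qed
  then have "cols A ! j = cols A ! k"
    using jk by (auto intro: eq_vecI)
  then show "j = k"
    using assms jk nth_eq_iff_index_eq[of "cols A" j k] by (simp add: simple_mat_def)
qed

text \<open>Matching the rows \<open>ys\<close> of \<open>F\<close> with the rows \<open>xs\<close>
  of the pattern sends each column of \<open>F\<close> to a column of \<open>A\<close> with the same
  entries. Simplicity of \<open>F\<close> makes this choice of columns injective.\<close>

lemma configuration_of_has_pattern:
  assumes A: "is_01_mat A" and F: "simple_mat F" "dim_col F > 0"
    and ys: "distinct ys" "set ys = {..<dim_row F}"
    and pat: "has_pattern \<Phi> {..<dim_row A} (col_support A ` {..<dim_col A})"
    and \<Phi>: "\<And>j. j < dim_col F \<Longrightarrow> map (\<lambda>i. F $$ (i, j) = 1) ys \<in> \<Phi>"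
  shows "F \<prec> A"
proof -
  from pat obtain xs where xs: "distinct xs" "set xs \<subseteq> {..<dim_row A}"
    and sub: "\<Phi> \<subseteq> (\<lambda>B. map (\<lambda>x. x \<in> B) xs) ` col_support A ` {..<dim_col A}"
    unfolding has_pattern_def by blast
  have "\<forall>j. \<exists>k. j < dim_col F \<longrightarrow> k < dim_col A \<and>
      map (\<lambda>i. F $$ (i, j) = 1) ys = map (\<lambda>x. x \<in> col_support A k) xs"
    using sub \<Phi> by blast
  then obtain \<kappa> where \<kappa>: "\<And>j. j < dim_col F \<Longrightarrow> \<kappa> j < dim_col A"
    "\<And>j. j < dim_col F \<Longrightarrow>
      map (\<lambda>i. F $$ (i, j) = 1) ys = map (\<lambda>x. x \<in> col_support A (\<kappa> j)) xs"
    by metis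
  \<comment> \<open>The two lengths are linked only through a column of \<open>F\<close>, so one
    must exist.\<close>
  have len: "length xs = length ys"
    using \<kappa>(2)[OF F(2)] by (metis length_map)
  \<comment> \<open>\<open>\<iota> i\<close> is the position of row \<open>i\<close> in
    \<open>ys\<close>.\<close>
  define \<iota> where "\<iota> = the_inv_into {..<length ys} ((!) ys)"
  have bij: "bij_betw ((!) ys) {..<length ys} {..<dim_row F}"
    using ys by (intro bij_betw_nth) auto
  then have \<iota>: "bij_betw \<iota> {..<dim_row F} {..<length ys}"
    unfolding \<iota>_def by (rule bij_betw_the_inv_into)
  have \<iota>_lt: "\<iota> i < length xs" and ys_\<iota>: "ys ! \<iota> i = i" if "i < dim_row F" for i
    using that \<iota> bij len f_the_inv_into_f_bij_betw[OF bij] bij_betwE[OF \<iota>]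
    by (auto simp: \<iota>_def)
  define \<rho> where "\<rho> i = xs ! \<iota> i" for i
  have \<rho>: "\<rho> i < dim_row A" if "i < dim_row F" for i
    using nth_mem[OF \<iota>_lt[OF that]] xs(2) unfolding \<rho>_def by blast
  have entry: "A $$ (\<rho> i, \<kappa> j) = F $$ (i, j)" if "i < dim_row F" "j < dim_col F" for i j
  proof -
    have "map (\<lambda>i. F $$ (i, j) = 1) ys ! \<iota> i = map (\<lambda>x. x \<in> col_support A (\<kappa> j)) xs ! \<iota> i"
      using \<kappa>(2)[OF that(2)] by simp
    then have "F $$ (i, j) = 1 \<longleftrightarrow> \<rho> i \<in> col_support A (\<kappa> j)"
      using \<iota>_lt ys_\<iota> len that by (simp add: \<rho>_def)
    also have "\<dots> \<longleftrightarrow> A $$ (\<rho> i, \<kappa> j) = 1"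
      using \<rho> that by (simp add: col_support_def)
    finally show ?thesis
      using A F(1) \<rho> \<kappa>(1) that unfolding simple_mat_def is_01_mat_iff by metis
  qed
  show ?thesis
  proof (rule configurationI[OF _ _ _ _ entry])
    show "inj_on \<rho> {..<dim_row F}"
    proof (rule inj_onI)
      fix i i' assume i: "i \<in> {..<dim_row F}" "i' \<in> {..<dim_row F}" "\<rho> i = \<rho> i'"
      then have "\<iota> i = \<iota> i'"
        using nth_eq_iff_index_eq[OF xs(1) \<iota>_lt \<iota>_lt] by (auto simp: \<rho>_def)
      then show "i = i'"
        using ys_\<iota> i by (metis lessThan_iff)
    qed
    show "inj_on \<kappa> {..<dim_col F}"
    proof (rule inj_onI)
      fix j j' assume j: "j \<in> {..<dim_col F}" "j' \<in> {..<dim_col F}" "\<kappa> j = \<kappa> j'"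
      have "F $$ (i, j) = F $$ (i, j')" if "i < dim_row F" for i
        using entry[OF that, of j] entry[OF that, of j'] j by simp
      then have "col_support F j = col_support F j'"
        by (auto simp: col_support_def)
      then show "j = j'"
        using inj_on_col_support[OF F(1)] j by (auto dest: inj_onD)
    qed
  qed (use \<rho> \<kappa>(1) in auto)
qed

section \<open>The forbidden matrices\<close>

lemmas forbidden_defs = F9_def F10_def F11_def F13_def complement_mat_def ones_mat_def
  mat_of_rows_list_def

lemma simple_matI:
  assumes "is_01_mat A"
    and "\<forall>j<dim_col A. \<forall>k<j. \<exists>i<dim_row A. A $$ (i, j) \<noteq> A $$ (i, k)"
  shows "simple_mat A"
proof -
  have "col A j \<noteq> col A k" if jk: "j < dim_col A" "k < j" for j k
  proof
    assume "col A j = col A k"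
    then have "A $$ (i, j) = A $$ (i, k)" if "i < dim_row A" for i
      using that jk by (metis index_col less_trans)
    with assms(2) jk show False
      by blast
  qed
  then show ?thesis
    using assms(1) unfolding simple_mat_def distinct_conv_nth
    by (metis cols_length cols_nth linorder_neqE_nat)
qed

lemma simple_forbidden:
  assumes "F \<in> {ones_mat 4 1, F9, F10, complement_mat F9, complement_mat F10, F11, F13}"
  shows "simple_mat F"
proof (rule simple_matI)
  show "is_01_mat F"
    using assms
    by (auto simp: is_01_mat_iff forbidden_defs less_Suc_eq numeral_eq_Suc)
  show "\<forall>j<dim_col F. \<forall>k<j. \<exists>i<dim_row F. F $$ (i, j) \<noteq> F $$ (i, k)"
    using assms by (auto simp: forbidden_defs numeral_eq_Suc Ex_less_Suc elim!: less_SucE)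
qed

text \<open>The list passed to \<open>configuration_of_has_pattern\<close> orders the rows of the forbidden
  matrix: the first two are the free rows, the last two are the rows that see only \<open>T2\<close> or \<open>I2\<close>.\<close>

lemma T2_configuration:
  assumes "is_01_mat A" "F \<in> {ones_mat 4 1, F9, F10, complement_mat F9, complement_mat F10}"
    and "has_pattern (free_row (free_row T2)) {..<dim_row A} (col_support A ` {..<dim_col A})"
  shows "F \<prec> A"
proof (cases "F = complement_mat F10")
  case True
  \<comment> \<open>Rows 2 and 3 of this matrix read 11, 11, 01, and 01 is not in \<open>T2\<close>;
    swapping them gives 11, 11, 10.\<close>
  show ?thesis
  proof (rule configuration_of_has_pattern[OF assms(1) _ _ _ _ assms(3), of _ "[0, 1, 3, 2]"])
    show "simple_mat F"
      using assms(2) by (intro simple_forbidden) auto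
  qed (auto simp: True forbidden_defs free_row_def T2_def less_Suc_eq numeral_eq_Suc)
next
  case False
  with assms(2) have F: "F \<in> {ones_mat 4 1, F9, F10, complement_mat F9}"
    by simp
  show ?thesis
  proof (rule configuration_of_has_pattern[OF assms(1) _ _ _ _ assms(3), of _ "[0, 1, 2, 3]"])
    show "simple_mat F"
      using F by (intro simple_forbidden) auto
  qed (use F in \<open>auto simp: forbidden_defs free_row_def T2_def less_Suc_eq numeral_eq_Suc\<close>)
qed

lemma I2_configuration:
  assumes "is_01_mat A" "F \<in> {F11, F13}"
    and "has_pattern (free_row (free_row I2)) {..<dim_row A} (col_support A ` {..<dim_col A})"
  shows "F \<prec> A"
\<comment> \<open>In both \<open>F11\<close> and \<open>F13\<close>, rows 0 and 3 are complementary,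
  so they show only 10 and 01.\<close>
proof (rule configuration_of_has_pattern[OF assms(1) _ _ _ _ assms(3), of _ "[1, 2, 0, 3]"])
  show "simple_mat F"
    using assms(2) by (intro simple_forbidden) auto
qed (use assms(2) in \<open>auto simp: forbidden_defs free_row_def I2_def less_Suc_eq numeral_eq_Suc\<close>)

section \<open>The bound on \<open>forb\<close>\<close>

text \<open>One more column would force one of the two patterns: \<open>T2\<close> with two free
  rows contains \<open>F\<close>, and \<open>I2\<close> with two free rows contains
  \<open>G\<close>.\<close>

lemma dim_col_avoiding_le:
  assumes F: "F \<in> {ones_mat 4 1, F9, F10, complement_mat F9, complement_mat F10}"
    and G: "G \<in> {F11, F13}" and A: "A \<in> avoiding m {F, G}"
  shows "dim_col A \<le> 1 + m\<^sup>2"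
proof (rule ccontr)
  assume "\<not> dim_col A \<le> 1 + m\<^sup>2"
  moreover have A': "simple_mat A" "dim_row A = m" "\<not> F \<prec> A" "\<not> G \<prec> A"
    using A by (auto simp: avoiding_def)
  moreover have "col_support A ` {..<dim_col A} \<subseteq> Pow {..<dim_row A}"
    by (auto simp: col_support_def)
  ultimately have "\<exists>\<Phi>\<in>{I2, T2}. has_pattern (free_row (free_row \<Phi>)) {..<dim_row A}
      (col_support A ` {..<dim_col A})"
    by (intro has_pattern_quadratic) (auto simp: card_image inj_on_col_support)
  then show False
    using T2_configuration[OF _ F] I2_configuration[OF _ G] A' by (auto simp: simple_mat_def)
qed

theorem proposition3p3:
  fixes F G :: "int mat"
  assumes "F \<in> {ones_mat 4 1, F9, F10, complement_mat F9, complement_mat F10}"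
    and "G \<in> {F11, F13}"
  shows "(\<lambda>m. real (forb m {F, G})) \<in> O(\<lambda>m. real m ^ 2)"
proof -
  \<comment> \<open>Nonzero width puts the matrix without columns among the avoiding ones, so
    \<open>Max\<close> ranges over a nonempty set.\<close>
  have "dim_col X > 0" if "X \<in> {F, G}" for X
    using that assms by (auto simp: forbidden_defs)
  then have "dim_col ` avoiding m {F, G} \<noteq> {}" for m
    by (rule avoiding_dims_nonempty)
  then have le: "forb m {F, G} \<le> 1 + m\<^sup>2" for m
    unfolding forb_def using finite_avoiding_dims dim_col_avoiding_le[OF assms]
    by (subst Max_le_iff) auto
  \<comment> \<open>For \<open>m \<ge> 1\<close> the constant 1 is at most m^2; at
    \<open>m = 0\<close> it could not be absorbed.\<close>
  have quadratic: "forb m {F, G} \<le> 2 * m\<^sup>2" if "m \<ge> 1" for m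
    using le[of m] one_le_power[OF that, of 2] by linarith
  then have "real (forb m {F, G}) \<le> 2 * real m ^ 2" if "m \<ge> 1" for m
    using of_nat_mono[OF quadratic[OF that], where ?'a = real] by simp
  then show ?thesis
    by (intro bigoI[of _ 2] eventually_sequentiallyI[of 1]) auto
qed

end
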